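(* Let $t\geq 1$, $\ell\geq 3$ and $k\geq t+\ell-2$ be integers. There is $n_0=n_0(k,t,\ell)$ such that for every $n\geq n_0$ the following holds. If $\mathcal{F}\subset\binom{[n]}{k}$ is a family such that $$\binom{\ell}{2}(t-1)+\binom{\ell-1}{2}\leq \sum_{1\leq i<j\leq \ell}|F_i\cap F_j|$$ holds for every choice of $\ell$ distinct members $F_1,\dots,F_\ell$ of $\mathcal{F}$, then $$|\mathcal{F}|\leq \binom{n-t}{k-t}+\binom{n-t-\ell+2}{k-t-\ell+3}.$$
   Context: $[n]=\{1,\dots,n\}$ and $\binom{[n]}{k}$ denotes the family of all $k$-element subsets of $[n]$. *)

theory Defs
  imports Complex_Main
begin

end

theory Submission
  imports Defs
begin

text \<open>
  Call sets whose pairwise intersections all equal \<open>T\<close> a sunflower with kernel \<open>T\<close>. A family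
  without large sunflowers with kernel of size less than \<open>s\<close> has only \<open>O(n\<^bsup>k-s\<^esup>)\<close> members.
  By hypothesis no \<open>l\<close> members form a sunflower with kernel smaller than \<open>t\<close>. So if no \<open>t\<close>-set is
  the kernel of a large sunflower, then the family has size \<open>O(n\<^bsup>k-t-1\<^esup>)\<close>. Otherwise fix such a
  kernel \<open>T\<close>. At most \<open>(n-t choose k-t)\<close> members contain \<open>T\<close>. Testing the hypothesis on one or two
  members not containing \<open>T\<close> together with petals avoiding them shows that the remaining members
  meet \<open>T\<close> in exactly \<open>t-1\<close> points and pairwise meet in at least \<open>t+l-3\<close> points. Hence either there
  are only \<open>O(n\<^bsup>k-t-l+2\<^esup>)\<close> of them, or they all contain one set of size \<open>t+l-3\<close> that
  contains all but one point \<open>x\<close> of \<open>T\<close>, and they all miss \<open>x\<close>.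
\<close>

section \<open>Sunflowers and the number of supersets of a fixed set\<close>

text \<open>Members are stored whole, kernel included. The first conjunct ties a one-member family
  to its kernel; the empty family is a sunflower with every kernel.\<close>

definition sunflower :: "'a set \<Rightarrow> 'a set set \<Rightarrow> bool" where
  "sunflower T P \<longleftrightarrow> (\<forall>A\<in>P. T \<subseteq> A) \<and> (\<forall>A\<in>P. \<forall>B\<in>P. A \<noteq> B \<longrightarrow> A \<inter> B = T)"

lemma card_supersets_le:
  assumes "finite X" "B \<subseteq> X"
  shows "card {A. B \<subseteq> A \<and> A \<subseteq> X \<and> card A = k} \<le> (card X - card B) choose (k - card B)"
proof -
  let ?S = "{A. B \<subseteq> A \<and> A \<subseteq> X \<and> card A = k}" and ?D = "{D. D \<subseteq> X - B \<and> card D = k - card B}"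
  have fB: "finite B" using assms finite_subset by blast
  have "card ?S \<le> card ?D"
  proof (rule card_inj_on_le[where f = "\<lambda>A. A - B"])
    show "inj_on (\<lambda>A. A - B) ?S" by (auto simp: inj_on_def)
    show "(\<lambda>A. A - B) ` ?S \<subseteq> ?D" using fB by (auto simp: card_Diff_subset)
    show "finite ?D" using assms(1) by simp
  qed
  also have "\<dots> = card (X - B) choose (k - card B)"
    using n_subsets[of "X - B"] assms(1) by simp
  also have "card (X - B) = card X - card B"
    using assms fB by (simp add: card_Diff_subset)
  finally show ?thesis .
qed

lemma binomial_le_power: "(n choose k) \<le> n ^ k"
proof (cases "k \<le> n")
  case True
  then show ?thesis by (rule binomial_le_pow)
qed (simp add: binomial_eq_0)

lemma card_supersets_le_power:
  assumes "finite X" "B \<subseteq> X"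
  shows "card {A. B \<subseteq> A \<and> A \<subseteq> X \<and> card A = k} \<le> card X ^ (k - card B)"
proof -
  have "(card X - card B) choose (k - card B) \<le> (card X - card B) ^ (k - card B)"
    by (rule binomial_le_power)
  also have "\<dots> \<le> card X ^ (k - card B)" by (rule power_mono) auto
  finally show ?thesis using card_supersets_le[OF assms, of k] by linarith
qed

section \<open>Families without large sunflowers\<close>

text \<open>Take a sunflower \<open>P\<close> with kernel \<open>B\<close> in \<open>F\<close>
  having the most members, and let \<open>U\<close> be its union without \<open>B\<close>. A member
  outside \<open>P\<close> that contains \<open>B\<close> and avoids \<open>U\<close> could be added
  to \<open>P\<close>, contradicting maximality.\<close>

lemma family_through_kernel_covered:
  assumes X: "finite X" and F: "F \<subseteq> {A. A \<subseteq> X \<and> card A = k}"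
    and few: "\<And>P. P \<subseteq> F \<Longrightarrow> sunflower B P \<Longrightarrow> card P < m"
    and B: "card B < k"
  shows "\<exists>U. U \<subseteq> X - B \<and> card U \<le> m * k \<and> (\<forall>A\<in>F. B \<subseteq> A \<longrightarrow> A \<inter> U \<noteq> {})"
proof -
  have finF: "finite F" by (rule finite_subset[OF F]) (use X in auto)
  define Q where "Q = {P. P \<subseteq> F \<and> sunflower B P}"
  have fQ: "finite (card ` Q)" using finF by (simp add: Q_def)
  moreover have "{} \<in> Q" by (simp add: Q_def sunflower_def)
  ultimately have "Max (card ` Q) \<in> card ` Q" by (intro Max_in) auto
  then obtain P where P: "P \<in> Q" "Max (card ` Q) = card P" by auto
  have max: "card P' \<le> card P" if "P' \<in> Q" for P'
    using Max_ge[OF fQ, of "card P'"] that P(2) by auto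
  have PF: "P \<subseteq> F" and sP: "sunflower B P" using P(1) by (auto simp: Q_def)
  have fP: "finite P" using PF finF finite_subset by blast
  define U where "U = \<Union>P - B"
  have fA: "finite A" if "A \<in> F" for A using that F X finite_subset by blast
  have "card U \<le> card (\<Union>P)"
    unfolding U_def using fP PF fA by (intro card_mono) auto
  also have "\<dots> \<le> (\<Sum>A\<in>P. card A)" by (rule card_Union_le_sum_card)
  also have "\<dots> = card P * k" using PF F by (subst sum.cong[where h = "\<lambda>_. k"]) auto
  also have "\<dots> \<le> m * k" using few[OF PF sP] by simp
  finally have cU: "card U \<le> m * k" .
  have "A \<inter> U \<noteq> {}" if A: "A \<in> F" "B \<subseteq> A" for A
  proof (cases "A \<in> P")
    case True
    \<comment> \<open>Since \<open>card B < k\<close>, a member of \<open>P\<close> is strictly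
      larger than the kernel and so has a point in \<open>U\<close>.\<close>
    have "A \<noteq> B" using A F B by auto
    then show ?thesis using True A(2) by (auto simp: U_def)
  next
    case False
    have "card (insert A P) > card P" using False fP by simp
    then have "insert A P \<notin> Q" using max by fastforce
    then have "\<not> sunflower B (insert A P)" using A PF by (auto simp: Q_def)
    then obtain C where "C \<in> P" "A \<inter> C \<noteq> B" "B \<subseteq> C"
      using sP A(2) unfolding sunflower_def by (auto simp: Int_commute)
    then show ?thesis using A(2) by (auto simp: U_def)
  qed
  moreover have "U \<subseteq> X - B" using PF F by (auto simp: U_def)
  ultimately show ?thesis using cU by blast
qed

text \<open>Branching: as long as \<open>card B < s\<close>, every member containing
  \<open>B\<close> also contains one of at most \<open>m * k\<close> further points. After
  \<open>s\<close> choices from the empty set, at most \<open>card X ^ (k - s)\<close> members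
  remain on each branch.\<close>

lemma card_le_if_no_sunflower:
  assumes X: "finite X" and F: "F \<subseteq> {A. A \<subseteq> X \<and> card A = k}" and "s \<le> k"
    and few: "\<And>P T. P \<subseteq> F \<Longrightarrow> sunflower T P \<Longrightarrow> card T < s \<Longrightarrow> card P < m"
  shows "card F \<le> (m * k) ^ s * card X ^ (k - s)"
proof -
  have finF: "finite F" by (rule finite_subset[OF F]) (use X in auto)
  \<comment> \<open>Here \<open>d\<close> counts the points still to be chosen before
    \<open>B\<close> has size \<open>s\<close>.\<close>
  have "card {A \<in> F. B \<subseteq> A} \<le> (m * k) ^ d * card X ^ (k - s)"
    if "B \<subseteq> X" "card B + d = s" for d B
    using that
  proof (induction d arbitrary: B)
    case 0
    have "card {A \<in> F. B \<subseteq> A} \<le> card {A. B \<subseteq> A \<and> A \<subseteq> X \<and> card A = k}"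
      using F X by (intro card_mono) auto
    also have "\<dots> \<le> card X ^ (k - card B)" using X 0 by (intro card_supersets_le_power)
    finally show ?case using 0 by simp
  next
    case (Suc d)
    obtain U where U: "U \<subseteq> X - B" "card U \<le> m * k" "\<And>A. A \<in> F \<Longrightarrow> B \<subseteq> A \<Longrightarrow> A \<inter> U \<noteq> {}"
      using family_through_kernel_covered[OF X F few, of B] Suc.prems \<open>s \<le> k\<close> by force
    have fU: "finite U" and fB: "finite B" using U(1) Suc.prems X finite_subset by blast+
    have "{A \<in> F. B \<subseteq> A} \<subseteq> (\<Union>x\<in>U. {A \<in> F. insert x B \<subseteq> A})" using U(3) by fast
    then have "card {A \<in> F. B \<subseteq> A} \<le> card (\<Union>x\<in>U. {A \<in> F. insert x B \<subseteq> A})"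
      using finF fU by (intro card_mono) auto
    also have "\<dots> \<le> (\<Sum>x\<in>U. card {A \<in> F. insert x B \<subseteq> A})" using fU by (rule card_UN_le)
    also have "\<dots> \<le> (\<Sum>x\<in>U. (m * k) ^ d * card X ^ (k - s))"
    proof (rule sum_mono)
      fix x assume "x \<in> U"
      then show "card {A \<in> F. insert x B \<subseteq> A} \<le> (m * k) ^ d * card X ^ (k - s)"
        using U(1) Suc.prems fB by (intro Suc.IH) auto
    qed
    also have "\<dots> = card U * ((m * k) ^ d * card X ^ (k - s))" by simp
    also have "\<dots> \<le> (m * k) * ((m * k) ^ d * card X ^ (k - s))" using U(2) by (rule mult_le_mono1)
    finally show ?case by (simp add: mult.assoc)
  qed
  from this[of "{}" s] show ?thesis by simp
qed

section \<open>Avoiding a set inside a sunflower, and sums over index pairs\<close>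

text \<open>Members of a sunflower are disjoint outside \<open>T\<close>, so each point of
  \<open>Z - T\<close> spoils at most one of them.\<close>

lemma card_sunflower_le_avoiding:
  assumes P: "finite P" "sunflower T P" and Z: "finite Z"
  shows "card P \<le> card {A \<in> P. A \<inter> Z \<subseteq> T} + card Z"
proof -
  let ?B = "{A \<in> P. \<not> A \<inter> Z \<subseteq> T}"
  define g where "g A = (SOME x. x \<in> A \<inter> Z - T)" for A
  have g: "g A \<in> A \<inter> Z - T" if "A \<in> ?B" for A
    unfolding g_def by (rule someI_ex) (use that in blast)
  have "inj_on g ?B"
  proof (rule inj_onI, rule ccontr)
    fix A C assume AC: "A \<in> ?B" "C \<in> ?B" "g A = g C" "A \<noteq> C"
    then have "A \<inter> C = T" using P(2) unfolding sunflower_def by blast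
    then show False using g[OF AC(1)] g[OF AC(2)] AC(3) by auto
  qed
  then have "card ?B \<le> card Z" using g Z by (intro card_inj_on_le[of g]) auto
  moreover have "card P = card {A \<in> P. A \<inter> Z \<subseteq> T} + card ?B"
    using P(1) by (subst card_Un_disjoint[symmetric]) (auto intro: arg_cong[where f = card])
  ultimately show ?thesis by simp
qed

text \<open>Splits off the pairs with largest index \<open>Suc m\<close>. This is used to append one
  or two further sets to a list of petals.\<close>

lemma sum_pairs_Suc:
  fixes h :: "nat \<Rightarrow> nat \<Rightarrow> nat"
  shows "(\<Sum>(i, j)\<in>{(i, j). 1 \<le> i \<and> i < j \<and> j \<le> Suc m}. h i j)
    = (\<Sum>(i, j)\<in>{(i, j). 1 \<le> i \<and> i < j \<and> j \<le> m}. h i j) + (\<Sum>i = 1..m. h i (Suc m))"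
proof -
  let ?S = "\<lambda>m. {(i, j). 1 \<le> i \<and> i < j \<and> j \<le> (m::nat)}"
  have eq: "?S (Suc m) = ?S m \<union> (\<lambda>i. (i, Suc m)) ` {1..m}" by (auto simp: le_Suc_eq)
  have "finite (?S m)" by (rule finite_subset[of _ "{..m} \<times> {..m}"]) auto
  then have "(\<Sum>(i, j)\<in>?S (Suc m). h i j) =
      (\<Sum>(i, j)\<in>?S m. h i j) + (\<Sum>(i, j)\<in>(\<lambda>i. (i, Suc m)) ` {1..m}. h i j)"
    unfolding eq by (intro sum.union_disjoint) auto
  also have "(\<Sum>(i, j)\<in>(\<lambda>i. (i, Suc m)) ` {1..m}. h i j) = (\<Sum>i = 1..m. h i (Suc m))"
    by (subst sum.reindex) (auto simp: inj_on_def)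
  finally show ?thesis .
qed

lemma sum_pairs_const:
  fixes h :: "nat \<Rightarrow> nat \<Rightarrow> nat"
  assumes "\<And>i j. 1 \<le> i \<Longrightarrow> i < j \<Longrightarrow> j \<le> m \<Longrightarrow> h i j = c"
  shows "(\<Sum>(i, j)\<in>{(i, j). 1 \<le> i \<and> i < j \<and> j \<le> m}. h i j) = (m choose 2) * c"
  using assms
proof (induction m)
  case 0
  have empty: "{(i, j). 1 \<le> i \<and> i < j \<and> j \<le> (0::nat)} = {}" by auto
  show ?case unfolding empty by (simp add: binomial_eq_0)
next
  case (Suc m)
  have "(\<Sum>i = 1..m. h i (Suc m)) = m * c" using Suc.prems by simp
  then show ?case unfolding sum_pairs_Suc using Suc
    by (simp add: numeral_2_eq_2 algebra_simps)
qed

lemma sunflower_enumeration: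
  assumes "finite P" "sunflower T P" "m \<le> card P"
  obtains f where "inj_on f {1..m}" "f ` {1..m} \<subseteq> P"
    "\<And>i j. 1 \<le> i \<Longrightarrow> i < j \<Longrightarrow> j \<le> m \<Longrightarrow> f i \<inter> f j = T"
proof -
  obtain f where f: "bij_betw f {1..card P} P"
    using ex_bij_betw_nat_finite_1[OF assms(1)] by blast
  have sub: "{1..m} \<subseteq> {1..card P}" using assms(3) by auto
  have inj: "inj_on f {1..m}" using f sub by (meson bij_betw_def inj_on_subset)
  have im: "f ` {1..m} \<subseteq> P" using f sub by (auto simp: bij_betw_def)
  have "f i \<inter> f j = T" if "1 \<le> i" "i < j" "j \<le> m" for i j
  proof -
    have "f i \<noteq> f j" using inj_onD[OF inj, of i j] that by auto
    moreover have "f i \<in> P" "f j \<in> P" using im that by auto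
    ultimately show ?thesis using assms(2) unfolding sunflower_def by blast
  qed
  then show ?thesis using that inj im by blast
qed

section \<open>Families with large pairwise intersections\<close>

text \<open>Suppose some \<open>S\<close> of size \<open>s\<close> is the kernel of more than
  \<open>k\<close> members. Any \<open>A\<close> in the family has only \<open>k\<close> points, so
  some petal \<open>C\<close> meets \<open>A\<close> only inside \<open>S\<close>; if
  \<open>C \<noteq> A\<close>, then \<open>s \<le> card (C \<inter> A)\<close> forces
  \<open>S = C \<inter> A\<close>. If there is no such \<open>S\<close>, all sunflowers with kernel
  of size at most \<open>s\<close> are small, and the branching bound applies with
  \<open>Suc s\<close>.\<close>

lemma common_subset_or_few:
  assumes X: "finite X" and G: "\<G> \<subseteq> {A. A \<subseteq> X \<and> card A = k}" and "s < k"
    and int: "\<And>A B. A \<in> \<G> \<Longrightarrow> B \<in> \<G> \<Longrightarrow> A \<noteq> B \<Longrightarrow> s \<le> card (A \<inter> B)"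
  shows "(\<exists>S. S \<subseteq> X \<and> card S = s \<and> (\<forall>A\<in>\<G>. S \<subseteq> A)) \<or>
    card \<G> \<le> (Suc k * k) ^ Suc s * card X ^ (k - Suc s)"
proof (cases "\<exists>P S. P \<subseteq> \<G> \<and> sunflower S P \<and> card S = s \<and> k < card P")
  case True
  then obtain P S where P: "P \<subseteq> \<G>" "sunflower S P" "card S = s" "k < card P" by blast
  have fP: "finite P" using P(4) card_ge_0_finite by force
  have "S \<subseteq> A" if A: "A \<in> \<G>" for A
  proof -
    have fA: "finite A" "card A = k" using A G X finite_subset by blast+
    have "card P \<le> card {C \<in> P. C \<inter> A \<subseteq> S} + card A"
      using fP P(2) fA(1) by (rule card_sunflower_le_avoiding)
    then have "{C \<in> P. C \<inter> A \<subseteq> S} \<noteq> {}" using P(4) fA(2) by force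
    then obtain C where C: "C \<in> P" "C \<inter> A \<subseteq> S" by blast
    have SC: "S \<subseteq> C" using P(2) C(1) by (auto simp: sunflower_def)
    show ?thesis
    proof (cases "C = A")
      case False
      have "C \<subseteq> X" using C(1) P(1) G by blast
      then have fS: "finite S" using SC X by (meson finite_subset)
      have "card S \<le> card (C \<inter> A)" using int[of C A] C(1) P(1,3) A False by auto
      then have "C \<inter> A = S" using C(2) fS by (meson card_seteq)
      then show ?thesis by auto
    qed (use SC in auto)
  qed
  moreover have "S \<subseteq> X"
  proof -
    obtain C where "C \<in> P" using P(4) by fastforce
    then have "S \<subseteq> C" "C \<in> \<G>" using P(1,2) by (auto simp: sunflower_def)
    then show ?thesis using G by blast
  qed
  ultimately show ?thesis using P(3) by blast
next
  case False
  have "card P < Suc k" if P: "P \<subseteq> \<G>" "sunflower T P" "card T < Suc s" for P T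
  proof (rule ccontr)
    assume "\<not> card P < Suc k"
    then have big: "k < card P" by simp
    then have "card T < s" using False P by (metis less_antisym)
    \<comment> \<open>As \<open>k\<close> is positive, \<open>P\<close> has two distinct members.
      They meet exactly in \<open>T\<close>, which is too small for \<open>int\<close>.\<close>
    have "\<not> card P \<le> Suc 0" using big \<open>s < k\<close> by simp
    then obtain A C where AC: "A \<in> P" "C \<in> P" "A \<noteq> C"
      by (metis card_le_Suc0_iff_eq card_ge_0_finite big gr_zeroI less_nat_zero_code)
    then have "A \<inter> C = T" using P(2) unfolding sunflower_def by blast
    then show False using int[of A C] AC P(1) \<open>card T < s\<close> by auto
  qed
  then show ?thesis using card_le_if_no_sunflower[OF X G, of "Suc s" "Suc k"] \<open>s < k\<close> by simp
qed

section \<open>Comparing powers with binomial coefficients\<close>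

lemma power_eventually_le_binomial:
  fixes c C a :: nat
  assumes "1 \<le> a"
  shows "\<exists>n0. \<forall>n\<ge>n0. C * n ^ (a - 1) \<le> (n - c) choose a"
proof (intro exI allI impI)
  \<comment> \<open>The first two summands give \<open>n - c \<ge> n / 2\<close> and
    \<open>n - c \<ge> a\<close>, as needed for the lower bound \<open>((n - c) / a) ^ a\<close> on
    the binomial coefficient. The last one lets a single factor \<open>n\<close> absorb all
    constants.\<close>
  fix n assume n: "2 * c + a + C * (2 * a) ^ a \<le> n"
  have "real (C * n ^ (a - 1)) * (2 * real a) ^ a = real (C * (2 * a) ^ a) * real n ^ (a - 1)"
    by simp
  also have "\<dots> \<le> real n * real n ^ (a - 1)"
    using n by (intro mult_right_mono) (simp_all only: of_nat_le_iff of_nat_0_le_iff zero_le_power)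
  also have "\<dots> = real n ^ a" using assms by (simp add: power_eq_if)
  finally have "real (C * n ^ (a - 1)) \<le> real n ^ a / (2 * real a) ^ a"
    using assms by (simp add: pos_le_divide_eq)
  also have "\<dots> = (real n / 2 / real a) ^ a" by (simp add: power_divide power_mult_distrib)
  also have "\<dots> \<le> (real (n - c) / real a) ^ a"
    using n by (intro power_mono divide_right_mono) auto
  also have "\<dots> \<le> real ((n - c) choose a)"
    using n by (intro binomial_ge_n_over_k_pow_k) auto
  finally show "C * n ^ (a - 1) \<le> (n - c) choose a" by linarith
qed

section \<open>Families satisfying the pair-sum condition\<close>

text \<open>The setting of the theorem over an arbitrary finite ground set. That the ground set is
  large enters later, as numerical inequalities in \<open>card_family_le\<close>.\<close>

locale pair_sum_family =
  fixes t l k :: nat and X :: "'a set" and \<F> :: "'a set set"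
  assumes t: "1 \<le> t" and l: "3 \<le> l" and k: "t + l - 2 \<le> k" and finX: "finite X"
    and uniform: "\<F> \<subseteq> {A. A \<subseteq> X \<and> card A = k}"
    and pair_sum: "\<And>F. inj_on F {1..l} \<Longrightarrow> F ` {1..l} \<subseteq> \<F> \<Longrightarrow>
       (l choose 2) * (t - 1) + ((l - 1) choose 2)
         \<le> (\<Sum>(i, j)\<in>{(i, j). 1 \<le> i \<and> i < j \<and> j \<le> l}. card (F i \<inter> F j))"
begin

lemma finite_family: "finite \<F>"
  by (rule finite_subset[OF uniform]) (use finX in auto)

lemma finite_member: "A \<in> \<F> \<Longrightarrow> finite A"
  using uniform finX finite_subset by blast

text \<open>For \<open>l\<close> such members the pair sum is at most
  \<open>(l choose 2) * (t - 1)\<close>, which falls short by \<open>(l - 1) choose 2\<close>, a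
  positive number because \<open>l \<ge> 3\<close>.\<close>

lemma sunflower_small_kernel:
  assumes "P \<subseteq> \<F>" "sunflower T P" "card T < t"
  shows "card P < l"
proof (rule ccontr)
  assume "\<not> card P < l"
  moreover have "finite P" using assms(1) finite_family finite_subset by blast
  ultimately obtain f where f: "inj_on f {1..l}" "f ` {1..l} \<subseteq> P"
    "\<And>i j. 1 \<le> i \<Longrightarrow> i < j \<Longrightarrow> j \<le> l \<Longrightarrow> f i \<inter> f j = T"
    using sunflower_enumeration[of P T l] assms(2) by (metis not_less)
  have "(l choose 2) * (t - 1) + ((l - 1) choose 2) \<le> (l choose 2) * card T"
    using pair_sum[OF f(1)] f(2) assms(1)
      sum_pairs_const[of l "\<lambda>i j. card (f i \<inter> f j)" "card T"] f(3) by auto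
  also have "\<dots> \<le> (l choose 2) * (t - 1)" using assms(3) by (intro mult_le_mono2) simp
  finally have "(l - 1) choose 2 = 0" by simp
  then show False using l by simp
qed

section \<open>Members seen from a large sunflower with kernel of size t\<close>

context
  fixes T P
  assumes P: "P \<subseteq> \<F>" "sunflower T P" "l + 2 * k \<le> card P" and T: "card T = t"
begin

lemma finite_kernel: "finite T" "T \<subseteq> X"
proof -
  have "P \<noteq> {}" using P(3) l by auto
  then obtain A where "A \<in> P" by blast
  then have "T \<subseteq> A" "A \<in> \<F>" using P(1,2) by (auto simp: sunflower_def)
  then show "T \<subseteq> X" using uniform by blast
  then show "finite T" using finX finite_subset by blast
qed

text \<open>At most \<open>2 * k\<close> of the \<open>l + 2 * k\<close> petals meet
  \<open>Z\<close> outside \<open>T\<close>, so \<open>l\<close> of them survive. The size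
  \<open>2 * k\<close> leaves room for \<open>Z\<close> to be the union of two members.\<close>

lemma petals_avoiding:
  assumes "finite Z" "card Z \<le> 2 * k" "m \<le> l"
  obtains f where "inj_on f {1..m}" "f ` {1..m} \<subseteq> \<F>"
    "\<And>i j. 1 \<le> i \<Longrightarrow> i < j \<Longrightarrow> j \<le> m \<Longrightarrow> f i \<inter> f j = T"
    "\<And>i. i \<in> {1..m} \<Longrightarrow> T \<subseteq> f i \<and> f i \<inter> Z = T \<inter> Z"
proof -
  let ?Q = "{A \<in> P. A \<inter> Z \<subseteq> T}"
  have fP: "finite P" using P(1) finite_family finite_subset by blast
  have "m \<le> card ?Q" using card_sunflower_le_avoiding[OF fP P(2) assms(1)] P(3) assms by linarith
  moreover have "sunflower T ?Q" using P(2) by (auto simp: sunflower_def)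
  moreover have "finite ?Q" using fP by simp
  ultimately obtain f where f: "inj_on f {1..m}" "f ` {1..m} \<subseteq> ?Q"
    "\<And>i j. 1 \<le> i \<Longrightarrow> i < j \<Longrightarrow> j \<le> m \<Longrightarrow> f i \<inter> f j = T"
    using sunflower_enumeration[of ?Q T m] by blast
  have sub: "f ` {1..m} \<subseteq> \<F>" using f(2) P(1) by blast
  have "T \<subseteq> f i \<and> f i \<inter> Z = T \<inter> Z" if "i \<in> {1..m}" for i
  proof -
    have "f i \<in> ?Q" using f(2) that by blast
    then show ?thesis using P(2) by (auto simp: sunflower_def)
  qed
  then show ?thesis by (intro that[OF f(1) sub f(3)])
qed

text \<open>The pair-sum condition is tested on \<open>G\<close> and \<open>l - 1\<close> petals
  that meet \<open>G\<close> only inside \<open>T\<close>. It yields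
  \<open>t - 1 \<le> card (T \<inter> G)\<close>, while \<open>\<not> T \<subseteq> G\<close> gives
  the strict upper bound \<open>t\<close>.\<close>

lemma card_Int_kernel:
  assumes G: "G \<in> \<F>" "\<not> T \<subseteq> G"
  shows "card (T \<inter> G) = t - 1"
proof -
  have lt: "card (T \<inter> G) < t"
    using psubset_card_mono[of T "T \<inter> G"] finite_kernel G(2) T by blast
  obtain m where m: "l = Suc m" using l by (cases l) auto
  have "finite G" "card G \<le> 2 * k" "m \<le> l" using G(1) uniform finite_member m by auto
  then obtain f where f: "inj_on f {1..m}" "f ` {1..m} \<subseteq> \<F>"
    "\<And>i j. 1 \<le> i \<Longrightarrow> i < j \<Longrightarrow> j \<le> m \<Longrightarrow> f i \<inter> f j = T"
    "\<And>i. i \<in> {1..m} \<Longrightarrow> T \<subseteq> f i \<and> f i \<inter> G = T \<inter> G"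
    by (rule petals_avoiding) blast
  define F where "F i = (if i \<le> m then f i else G)" for i
  have F_simps: "F (Suc m) = G" "\<And>i. i \<le> m \<Longrightarrow> F i = f i" by (simp_all add: F_def)
  have Fm: "F ` {1..m} = f ` {1..m}" by (intro image_cong) (auto simp: F_simps)
  have "inj_on F {1..m}" using f(1) by (rule inj_on_cong[THEN iffD1, rotated]) (simp add: F_simps)
  moreover have "G \<notin> f ` {1..m}" using f(4) G(2) by blast
  ultimately have "inj_on F {1..l}"
    unfolding m by (simp add: atLeastAtMostSuc_conv Fm[simplified] F_simps)
  moreover have "F ` {1..l} \<subseteq> \<F>" using f(2) G(1) by (auto simp: F_def)
  moreover have "(\<Sum>(i, j)\<in>{(i, j). 1 \<le> i \<and> i < j \<and> j \<le> l}. card (F i \<inter> F j))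
      = (m choose 2) * t + m * card (T \<inter> G)"
  proof -
    have "(\<Sum>i = 1..m. card (F i \<inter> F (Suc m))) = (\<Sum>i = 1..m. card (T \<inter> G))"
      using f(4) by (intro sum.cong) (auto simp: F_def)
    moreover have "(\<Sum>(i, j)\<in>{(i, j). 1 \<le> i \<and> i < j \<and> j \<le> m}. card (F i \<inter> F j)) = (m choose 2) * t"
      using f(3) T by (intro sum_pairs_const) (auto simp: F_def)
    ultimately show ?thesis unfolding m sum_pairs_Suc by simp
  qed
  ultimately have ineq: "(l choose 2) * (t - 1) + ((l - 1) choose 2)
      \<le> (m choose 2) * t + m * card (T \<inter> G)"
    using pair_sum[of F] by linarith
  obtain u where u: "t = Suc u" using t by (cases t) auto
  \<comment> \<open>With \<open>l choose 2 = (m choose 2) + m\<close>, the left side of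
    \<open>ineq\<close> equals \<open>(m choose 2) * t + m * u\<close>, and the first terms
    cancel.\<close>
  have "m * u \<le> m * card (T \<inter> G)"
    using ineq unfolding m u by (simp add: numeral_2_eq_2 algebra_simps)
  then show ?thesis using lt l m u by simp
qed

text \<open>Now the test uses \<open>G\<close>, \<open>H\<close> and \<open>m = l - 2\<close> petals
  avoiding both outside \<open>T\<close>. Each of the \<open>2 * m\<close> pairs of a petal with
  \<open>G\<close> or \<open>H\<close> contributes \<open>t - 1\<close>. As
  \<open>l choose 2 = (m choose 2) + 2 * m + 1\<close> and
  \<open>(l - 1) choose 2 = (m choose 2) + m\<close>, what is left for
  \<open>card (G \<inter> H)\<close> is at least \<open>t - 1 + m\<close>.\<close>

lemma card_Int_ge:
  assumes G: "G \<in> \<F>" "\<not> T \<subseteq> G" and H: "H \<in> \<F>" "\<not> T \<subseteq> H" and "G \<noteq> H"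
  shows "t + l - 3 \<le> card (G \<inter> H)"
proof -
  define m where "m = l - 2"
  then have m: "l = Suc (Suc m)" using l by simp
  have "card G = k" "card H = k" using G(1) H(1) uniform by blast+
  then have GH: "finite (G \<union> H)" "card (G \<union> H) \<le> 2 * k" "m \<le> l"
    using card_Un_le[of G H] finite_member[OF G(1)] finite_member[OF H(1)] m by simp_all
  obtain f where f: "inj_on f {1..m}" "f ` {1..m} \<subseteq> \<F>"
    "\<And>i j. 1 \<le> i \<Longrightarrow> i < j \<Longrightarrow> j \<le> m \<Longrightarrow> f i \<inter> f j = T"
    "\<And>i. i \<in> {1..m} \<Longrightarrow> T \<subseteq> f i \<and> f i \<inter> (G \<union> H) = T \<inter> (G \<union> H)"
    using GH by (rule petals_avoiding) blast
  have fG: "f i \<inter> G = T \<inter> G" "f i \<inter> H = T \<inter> H" if "i \<in> {1..m}" for i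
    using f(4)[OF that] by blast+
  define F where "F i = (if i \<le> m then f i else if i = Suc m then G else H)" for i
  have F_simps: "F (Suc m) = G" "F (Suc (Suc m)) = H" "\<And>i. i \<le> m \<Longrightarrow> F i = f i"
    by (simp_all add: F_def)
  have Fm: "F ` {1..m} = f ` {1..m}" by (intro image_cong) (auto simp: F_simps)
  have "inj_on F {1..m}" using f(1) by (rule inj_on_cong[THEN iffD1, rotated]) (simp add: F_simps)
  moreover have "G \<notin> f ` {1..m}" "H \<notin> f ` {1..m}" using f(4) G(2) H(2) by blast+
  ultimately have "inj_on F {1..l}" using \<open>G \<noteq> H\<close>
    unfolding m by (simp add: atLeastAtMostSuc_conv Fm[simplified] F_simps)
  moreover have "F ` {1..l} \<subseteq> \<F>" using f(2) G(1) H(1) by (auto simp: F_def)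
  moreover have "(\<Sum>(i, j)\<in>{(i, j). 1 \<le> i \<and> i < j \<and> j \<le> l}. card (F i \<inter> F j))
      = (m choose 2) * t + m * (t - 1) + m * (t - 1) + card (G \<inter> H)"
  proof -
    have "(\<Sum>i = 1..m. card (F i \<inter> F (Suc m))) = (\<Sum>i = 1..m. t - 1)"
      using fG(1) card_Int_kernel[OF G] by (intro sum.cong) (auto simp: F_def)
    moreover have "(\<Sum>i = 1..m. card (F i \<inter> F (Suc (Suc m)))) = (\<Sum>i = 1..m. t - 1)"
      using fG(2) card_Int_kernel[OF H] by (intro sum.cong) (auto simp: F_def)
    moreover have "card (F (Suc m) \<inter> F (Suc (Suc m))) = card (G \<inter> H)" by (simp add: F_def)
    moreover have "(\<Sum>(i, j)\<in>{(i, j). 1 \<le> i \<and> i < j \<and> j \<le> m}. card (F i \<inter> F j)) = (m choose 2) * t"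
      using f(3) T by (intro sum_pairs_const) (auto simp: F_def)
    ultimately show ?thesis unfolding m sum_pairs_Suc by simp
  qed
  ultimately have ineq: "(l choose 2) * (t - 1) + ((l - 1) choose 2)
      \<le> (m choose 2) * t + m * (t - 1) + m * (t - 1) + card (G \<inter> H)"
    using pair_sum[of F] by linarith
  obtain u where u: "t = Suc u" using t by (cases t) auto
  show ?thesis using ineq unfolding m u by (simp add: numeral_2_eq_2 algebra_simps)
qed

text \<open>The dichotomy for pairwise intersections is applied with \<open>s = t + l - 3\<close>.
  The three bounds on \<open>N\<close> serve, in order, the case of few members, a common subset
  \<open>S\<close> where \<open>T - S\<close> is not a singleton, and one where it is. Only the last
  case produces the binomial coefficient of the theorem.\<close>

lemma card_not_containing_kernel_le:
  assumes large: "(Suc k * k) ^ (t + l - 2) * card X ^ (k + 2 - t - l) \<le> N"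
    "t * card X ^ (k + 2 - t - l) \<le> N"
    "(card X + 2 - t - l) choose (k + 3 - t - l) \<le> N"
  shows "card {G \<in> \<F>. \<not> T \<subseteq> G} \<le> N"
proof -
  let ?G = "{G \<in> \<F>. \<not> T \<subseteq> G}"
  define s where "s = t + l - 3"
  \<comment> \<open>The condition \<open>s < k\<close> is exactly
    \<open>t + l - 2 \<le> k\<close>.\<close>
  have arith: "Suc s = t + l - 2" "k - (t + l - 2) = k + 2 - t - l" "k - s = k + 3 - t - l" "s < k"
    using t l k by (auto simp: s_def)
  have "(\<exists>S. S \<subseteq> X \<and> card S = s \<and> (\<forall>A\<in>?G. S \<subseteq> A)) \<or>
      card ?G \<le> (Suc k * k) ^ Suc s * card X ^ (k - Suc s)"
    using finX uniform card_Int_ge arith(4) by (intro common_subset_or_few) (auto simp: s_def)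
  then show ?thesis
  proof
    assume "card ?G \<le> (Suc k * k) ^ Suc s * card X ^ (k - Suc s)"
    then show ?thesis using large(1) unfolding arith by linarith
  next
    assume "\<exists>S. S \<subseteq> X \<and> card S = s \<and> (\<forall>A\<in>?G. S \<subseteq> A)"
    then obtain S where S: "S \<subseteq> X" "card S = s" "\<And>A. A \<in> ?G \<Longrightarrow> S \<subseteq> A" by blast
    have fS: "finite S" using S(1) finX finite_subset by blast
    show ?thesis
    \<comment> \<open>Every member in question contains \<open>S\<close> and misses exactly one
      point of \<open>T\<close>, which then lies in \<open>T - S\<close>. If
      \<open>T - S = {x}\<close>, all of them miss \<open>x\<close>, so they live in
      \<open>X - {x}\<close>. Otherwise each contains \<open>S\<close> and a further point of
      \<open>T - S\<close>, which saves a factor \<open>card X\<close> at the cost of at most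
      \<open>t\<close> choices.\<close>
    proof (cases "\<exists>x. T - S = {x}")
      case True
      then obtain x where x: "T - S = {x}" by blast
      have "?G \<subseteq> {A. S \<subseteq> A \<and> A \<subseteq> X - {x} \<and> card A = k}"
      proof
        fix A assume A: "A \<in> ?G"
        have SA: "S \<subseteq> A" using S(3) A by blast
        have "T \<subseteq> insert x S" using x by blast
        then have "x \<notin> A" using A SA by blast
        then show "A \<in> {A. S \<subseteq> A \<and> A \<subseteq> X - {x} \<and> card A = k}" using SA A uniform by blast
      qed
      then have "card ?G \<le> card {A. S \<subseteq> A \<and> A \<subseteq> X - {x} \<and> card A = k}"
        using finX by (intro card_mono) auto
      also have "\<dots> \<le> (card (X - {x}) - card S) choose (k - card S)"
        using x S(1) finX by (intro card_supersets_le) auto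
      also have "card (X - {x}) - card S = card X + 2 - t - l"
        using x finite_kernel t l S(2) by (subst card_Diff_singleton) (auto simp: s_def)
      finally show ?thesis using large(3) S(2) arith(3) by simp
    next
      case False
      have cov: "?G \<subseteq> (\<Union>x\<in>T - S. {A. insert x S \<subseteq> A \<and> A \<subseteq> X \<and> card A = k})"
      proof
        fix A assume A: "A \<in> ?G"
        have SA: "S \<subseteq> A" using S(3) A by blast
        have "\<exists>x. x \<in> T - S \<and> x \<in> A"
        proof (rule ccontr)
          assume "\<not> ?thesis"
          then have "T - S = T - A" using SA by blast
          moreover have "card (T - A) = 1"
            using card_Int_kernel[of A] A finite_kernel T t by (simp add: card_Diff_subset_Int)
          ultimately show False using False by (metis card_1_singletonE)
        qed
        then show "A \<in> (\<Union>x\<in>T - S. {A. insert x S \<subseteq> A \<and> A \<subseteq> X \<and> card A = k})"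
          using SA A uniform by auto
      qed
      have "card ?G \<le> card (\<Union>x\<in>T - S. {A. insert x S \<subseteq> A \<and> A \<subseteq> X \<and> card A = k})"
        using cov finX finite_kernel by (intro card_mono) auto
      also have "\<dots> \<le> (\<Sum>x\<in>T - S. card {A. insert x S \<subseteq> A \<and> A \<subseteq> X \<and> card A = k})"
        using finite_kernel by (intro card_UN_le) auto
      also have "\<dots> \<le> (\<Sum>x\<in>T - S. card X ^ (k - Suc s))"
      proof (rule sum_mono)
        fix x assume x: "x \<in> T - S"
        have "card (insert x S) = Suc s" using x fS S(2) by simp
        then show "card {A. insert x S \<subseteq> A \<and> A \<subseteq> X \<and> card A = k} \<le> card X ^ (k - Suc s)"
          using card_supersets_le_power[of X "insert x S" k] finX S(1) x finite_kernel by auto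
      qed
      also have "\<dots> = card (T - S) * card X ^ (k - Suc s)" by simp
      also have "\<dots> \<le> t * card X ^ (k - Suc s)"
        using card_mono[of T "T - S"] finite_kernel T by (intro mult_le_mono1) auto
      finally show ?thesis using large(2) unfolding arith by linarith
    qed
  qed
qed

end

section \<open>The bound for a fixed ground set\<close>

text \<open>If a \<open>t\<close>-set \<open>T\<close> is the kernel of \<open>l + 2 * k\<close>
  members, the two summands bound the members containing \<open>T\<close> and the others. If not,
  the branching bound with \<open>Suc t\<close> already lies below the first summand.\<close>

lemma card_family_le:
  assumes large: "((l + 2 * k) * k) ^ Suc t * card X ^ (k - t - 1) \<le> (card X - t) choose (k - t)"
    "(Suc k * k) ^ (t + l - 2) * card X ^ (k + 2 - t - l) \<le> (card X + 2 - t - l) choose (k + 3 - t - l)"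
    "t * card X ^ (k + 2 - t - l) \<le> (card X + 2 - t - l) choose (k + 3 - t - l)"
  shows "card \<F> \<le> ((card X - t) choose (k - t)) + ((card X + 2 - t - l) choose (k + 3 - t - l))"
proof (cases "\<exists>T P. P \<subseteq> \<F> \<and> sunflower T P \<and> l + 2 * k \<le> card P \<and> card T = t")
  case True
  then obtain T P where TP: "P \<subseteq> \<F>" "sunflower T P" "l + 2 * k \<le> card P" "card T = t" by blast
  have "card {A \<in> \<F>. T \<subseteq> A} \<le> card {A. T \<subseteq> A \<and> A \<subseteq> X \<and> card A = k}"
    using uniform finX by (intro card_mono) auto
  also have "\<dots> \<le> (card X - t) choose (k - t)"
    using card_supersets_le[of X T k] finX finite_kernel[OF TP] TP(4) by simp
  finally have "card {A \<in> \<F>. T \<subseteq> A} \<le> (card X - t) choose (k - t)" .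
  moreover have "card {A \<in> \<F>. \<not> T \<subseteq> A} \<le> (card X + 2 - t - l) choose (k + 3 - t - l)"
    using card_not_containing_kernel_le[OF TP large(2,3)] by simp
  moreover have "card \<F> = card {A \<in> \<F>. T \<subseteq> A} + card {A \<in> \<F>. \<not> T \<subseteq> A}"
    using finite_family by (subst card_Un_disjoint[symmetric]) (auto intro: arg_cong[where f = card])
  ultimately show ?thesis by linarith
next
  case none: False
  have "card P < l + 2 * k" if "P \<subseteq> \<F>" "sunflower T P" "card T < Suc t" for P T
  proof (cases "card T = t")
    case True
    then have "\<not> l + 2 * k \<le> card P" using none that by blast
    then show ?thesis by simp
  next
    case False
    then show ?thesis using sunflower_small_kernel[of P T] that by simp
  qed
  then have "card \<F> \<le> ((l + 2 * k) * k) ^ Suc t * card X ^ (k - Suc t)"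
    using finX uniform t l k by (intro card_le_if_no_sunflower) auto
  then show ?thesis using large(1) by simp
qed

end

section \<open>The choice of the threshold\<close>

theorem theorem6:
  fixes t l k :: nat
  assumes "t \<ge> 1" and "l \<ge> 3" and "k \<ge> t + l - 2"
  shows "\<exists>n0::nat. \<forall>n\<ge>n0. \<forall>\<F>::nat set set.
    \<F> \<subseteq> {A. A \<subseteq> {1..n} \<and> card A = k} \<longrightarrow>
    (\<forall>F::nat \<Rightarrow> nat set. inj_on F {1..l} \<and> F ` {1..l} \<subseteq> \<F> \<longrightarrow>
       (l choose 2) * (t - 1) + ((l - 1) choose 2)
         \<le> (\<Sum>(i, j)\<in>{(i, j). 1 \<le> i \<and> i < j \<and> j \<le> l}. card (F i \<inter> F j))) \<longrightarrow>
    card \<F> \<le> ((n - t) choose (k - t)) + ((n + 2 - t - l) choose (k + 3 - t - l))"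
proof -
  \<comment> \<open>Both lower indices must be positive for the comparison of powers. The first uses
    \<open>l \<ge> 3\<close>; in the second, adding 3 before subtracting prevents
    truncation.\<close>
  have pos: "1 \<le> k - t" "1 \<le> k + 3 - t - l" using assms by auto
  obtain n1 where n1: "\<And>n. n \<ge> n1 \<Longrightarrow>
      ((l + 2 * k) * k) ^ Suc t * n ^ (k - t - 1) \<le> (n - t) choose (k - t)"
    using power_eventually_le_binomial[OF pos(1), of "((l + 2 * k) * k) ^ Suc t" t] by blast
  \<comment> \<open>One constant dominates both coefficients of \<open>n ^ (k + 2 - t - l)\<close>,
    so a single threshold \<open>n2\<close> serves both bounds.\<close>
  define C where "C = (Suc k * k) ^ (t + l - 2) + t"
  have arith: "k + 3 - t - l - 1 = k + 2 - t - l" "n - (t + l - 2) = n + 2 - t - l" for n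
    using assms by auto
  obtain n2 where n2: "\<And>n. n \<ge> n2 \<Longrightarrow>
      C * n ^ (k + 2 - t - l) \<le> (n + 2 - t - l) choose (k + 3 - t - l)"
    using power_eventually_le_binomial[OF pos(2), of C "t + l - 2"] unfolding arith by blast
  show ?thesis
  proof (intro exI[of _ "max n1 n2"] allI impI)
    fix n :: nat and \<F> :: "nat set set"
    assume n: "max n1 n2 \<le> n" and F: "\<F> \<subseteq> {A. A \<subseteq> {1..n} \<and> card A = k}"
      and sums: "\<forall>F::nat \<Rightarrow> nat set. inj_on F {1..l} \<and> F ` {1..l} \<subseteq> \<F> \<longrightarrow>
       (l choose 2) * (t - 1) + ((l - 1) choose 2)
         \<le> (\<Sum>(i, j)\<in>{(i, j). 1 \<le> i \<and> i < j \<and> j \<le> l}. card (F i \<inter> F j))"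
    interpret pair_sum_family t l k "{1..n}" \<F>
      using assms F sums by unfold_locales auto
    have "(Suc k * k) ^ (t + l - 2) * n ^ (k + 2 - t - l) \<le> C * n ^ (k + 2 - t - l)"
      "t * n ^ (k + 2 - t - l) \<le> C * n ^ (k + 2 - t - l)"
      unfolding C_def by (intro mult_le_mono1, simp)+
    then have
      "(Suc k * k) ^ (t + l - 2) * n ^ (k + 2 - t - l) \<le> (n + 2 - t - l) choose (k + 3 - t - l)"
      "t * n ^ (k + 2 - t - l) \<le> (n + 2 - t - l) choose (k + 3 - t - l)"
      using n2[of n] n by linarith+
    then show "card \<F> \<le> ((n - t) choose (k - t)) + ((n + 2 - t - l) choose (k + 3 - t - l))"
      using card_family_le n1[of n] n by simp
  qed
qed

end
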